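(* Let $(M,d)$ be a complete metric space, let $E$ be a uniformly convex (real) Banach space, and let $i:M\to E$ be an isometrical immersion, i.e. $\|i(x)-i(y)\|=d(x,y)$ for all $x,y\in M$. If $x,y\in M$ satisfy $d(x,y)=d^g(x,y)$, then the whole segment $\{(1-s)\,i(x)+s\,i(y) : s\in[0,1]\}$ is contained in $i(M)$. In particular, if $(M,d)$ is path-metric (that is, $d=d^g$), then $i(M)$ is convex, and any two points of $M$ can be joined by a unique minimal geodesic (unique up to reparametrization).
   Context: For a metric space $(M,d)$, the length of a continuous curve $\gamma:[\alpha,\beta]\to M$ is $\operatorname{len}^d\gamma=\sup_T\sum_{i=1}^n d(\gamma(t_{i-1}),\gamma(t_i))$, the supremum being over all finite subsets $T=\{t_0\le\dots\le t_n\}$ of $[\alpha,\beta]$. The induced geodesic distance is $d^g(x,y)=\inf_\gamma \operatorname{len}^d\gamma\in[0,\infty]$, the infimum being over all continuous curves $\gamma$ in $(M,d)$ connecting $x$ to $y$ (it is $+\infty$ if there is no such curve of finite length). A (minimal) geodesic between $x$ and $y$ is a continuous curve connecting $x$ to $y$ with $\operatorname{len}^d\gamma=d^g(x,y)$. $(M,d)$ is called path-metric (and $d$ intrinsic) if $d=d^g$. A Banach space $E$ is uniformly convex if for every $\varepsilon>0$ there is $\delta>0$ such that for all $x,y\in E$ with $\|x\|\le1$, $\|y\|\le 1$, $\|x-y\|\ge\varepsilon$ one has $\|(x+y)/2\|<1-\delta$. Uniqueness up to reparametrization means that any two such geodesics have the same parametrization by arc length. *)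

theory Defs
  imports "HOL-Analysis.Analysis"
begin

definition uniformly_convex :: "'e::real_normed_vector itself \<Rightarrow> bool" where
  "uniformly_convex _ \<longleftrightarrow>
     (\<forall>\<epsilon>>0. \<exists>\<delta>>0. \<forall>x y::'e.
        norm x \<le> 1 \<and> norm y \<le> 1 \<and> norm (x - y) \<ge> \<epsilon> \<longrightarrow> norm ((x + y) /\<^sub>R 2) < 1 - \<delta>)"

text \<open>The supremum runs over finite sequences \<open>t 0 \<le> \<dots> \<le> t n\<close> in \<open>{a..b}\<close>; repeated points
  contribute zero summands, so this is the supremum over finite nonempty subsets. On \<open>{a..b}\<close>
  with \<open>a > b\<close> it is junk; all uses below have \<open>a \<le> b\<close>.\<close>

definition curve_length :: "real \<Rightarrow> real \<Rightarrow> (real \<Rightarrow> 'm::metric_space) \<Rightarrow> ennreal" where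
  "curve_length a b \<gamma> =
     (SUP (n, t) \<in> {(n::nat, t::nat \<Rightarrow> real). t ` {0..n} \<subseteq> {a..b} \<and> mono_on {0..n} t}.
        \<Sum>i=1..n. ennreal (dist (\<gamma> (t (i - 1))) (\<gamma> (t i))))"

definition curve_from_to ::
    "real \<Rightarrow> real \<Rightarrow> (real \<Rightarrow> 'm::metric_space) \<Rightarrow> 'm \<Rightarrow> 'm \<Rightarrow> bool" where
  "curve_from_to a b \<gamma> x y \<longleftrightarrow> a \<le> b \<and> continuous_on {a..b} \<gamma> \<and> \<gamma> a = x \<and> \<gamma> b = y"

text \<open>The infimum of the empty set in \<^typ>\<open>ennreal\<close> is \<open>\<infinity>\<close>, as required when no curve
  connects the two points.\<close>

definition geodesic_dist :: "'m::metric_space \<Rightarrow> 'm \<Rightarrow> ennreal" where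
  "geodesic_dist x y = (INF (a, b, \<gamma>) \<in> {(a, b, \<gamma>). curve_from_to a b \<gamma> x y}. curve_length a b \<gamma>)"

definition minimal_geodesic ::
    "real \<Rightarrow> real \<Rightarrow> (real \<Rightarrow> 'm::metric_space) \<Rightarrow> 'm \<Rightarrow> 'm \<Rightarrow> bool" where
  "minimal_geodesic a b \<gamma> x y \<longleftrightarrow>
     curve_from_to a b \<gamma> x y \<and> curve_length a b \<gamma> = geodesic_dist x y"

definition path_metric :: "'m::metric_space itself \<Rightarrow> bool" where
  "path_metric _ \<longleftrightarrow> (\<forall>x y::'m. ennreal (dist x y) = geodesic_dist x y)"

text \<open>\<open>\<sigma>\<close>, defined on \<open>{0..L}\<close> with \<open>L < \<infinity>\<close> the length of \<open>\<gamma>\<close> on \<open>{a..b}\<close>, is the parametrization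
  of \<open>\<gamma>\<close> by arc length: it has unit speed, and \<open>\<gamma>\<close> is \<open>\<sigma>\<close> composed with the arc length
  function of \<open>\<gamma>\<close>. Values of \<open>\<sigma>\<close> outside \<open>{0..L}\<close> are irrelevant. Since the arc length function of
  a continuous curve of finite length maps \<open>{a..b}\<close> onto \<open>{0..L}\<close>, \<open>\<sigma>\<close> is determined on \<open>{0..L}\<close>.\<close>

definition arclength_parametrization ::
    "real \<Rightarrow> real \<Rightarrow> (real \<Rightarrow> 'm::metric_space) \<Rightarrow> (real \<Rightarrow> 'm) \<Rightarrow> bool" where
  "arclength_parametrization a b \<gamma> \<sigma> \<longleftrightarrow>
     curve_length a b \<gamma> < \<infinity> \<and>
     continuous_on {0..enn2real (curve_length a b \<gamma>)} \<sigma> \<and>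
     (\<forall>s\<in>{0..enn2real (curve_length a b \<gamma>)}. curve_length 0 s \<sigma> = ennreal s) \<and>
     (\<forall>t\<in>{a..b}. \<gamma> t = \<sigma> (enn2real (curve_length a t \<gamma>)))"

end

theory Submission
  imports Defs
begin

text \<open>
  A point \<open>z\<close> on a curve from \<open>x\<close> to \<open>y\<close> satisfies \<open>dist x z + dist z y \<le> len\<close>.  If the length
  exceeds \<open>D = dist x y\<close> by at most \<open>\<eta>\<close>, the triangle inequality for \<open>x, z, y\<close> is therefore an
  equality up to \<open>\<eta>\<close>.  In a uniformly convex space such near-equality is rigid: it forces \<open>z\<close> to lie
  near the point of the segment from \<open>x\<close> to \<open>y\<close> that has the same distance to \<open>x\<close>
  (\<open>uniformly_convex_near_triangle_equality\<close>).

  When \<open>dist x y = geodesic_dist x y\<close>, curves with arbitrarily small excess \<open>\<eta>\<close> exist, and by the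
  intermediate value theorem each of them contains a point at any prescribed distance
  \<open>s * D\<close> from \<open>x\<close>.  The images of these points converge to the point of the segment with parameter
  \<open>s\<close>; since \<open>M\<close> is complete and \<open>i\<close> is an isometry, \<open>i(M)\<close> is closed and contains the limit.

  In a path-metric space the segment thus pulls back to an isometric embedding
  \<open>\<sigma>\<close> of \<open>[0, D]\<close>, which is a minimal geodesic.  Conversely, along a minimal geodesic \<open>\<gamma>\<close> there is no
  excess at all: the length travelled up to time \<open>t\<close> equals \<open>dist x (\<gamma> t)\<close>, and the rigidity, now
  exact, gives \<open>\<gamma> t = \<sigma> (length up to t)\<close>.  So \<open>\<sigma>\<close> is the arc length parametrization of every
  minimal geodesic from \<open>x\<close> to \<open>y\<close>.
\<close>

section \<open>Near-equality in the triangle inequality\<close>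

text \<open>
  The vector \<open>B u - A v\<close> measures how far \<open>u\<close> and \<open>v\<close> are from being the two pieces, of lengths \<open>A\<close>
  and \<open>B\<close>, of the segment spanned by \<open>u + v\<close>.  After normalising \<open>u\<close> and \<open>v\<close> into the unit ball as
  \<open>a\<close> and \<open>b\<close>, one splits off the equal weights
  \<open>m = min A B\<close> from the combination \<open>u + v = A a + (B + \<eta>) b\<close>.  If \<open>a\<close> and \<open>b\<close> were far apart, uniform
  convexity would make \<open>m (a + b)\<close> shorter than \<open>2 m\<close> by a fixed amount, and this loss would exceed
  the slack \<open>\<eta>\<close>.
\<close>

lemma uniformly_convex_near_triangle_equality:
  assumes uc: "uniformly_convex TYPE('e::real_normed_vector)"
    and A: "A \<ge> 0" and B: "B \<ge> 0" and \<epsilon>: "\<epsilon> > 0"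
  obtains \<eta> where "\<eta> > 0"
    and "\<And>u v::'e. norm u \<le> A \<Longrightarrow> norm v \<le> B + \<eta> \<Longrightarrow> norm (u + v) \<ge> A + B
           \<Longrightarrow> norm (B *\<^sub>R u - A *\<^sub>R v) < \<epsilon>"
proof -
  consider "A = 0" | "A > 0" "B = 0" | "A > 0" "B > 0"
    using A B by linarith
  then show ?thesis
  proof cases
    case 1
    show ?thesis by (rule that[of 1]) (use 1 \<epsilon> in auto)
  next
    case 2
    have "norm (B *\<^sub>R u - A *\<^sub>R v) < \<epsilon>" if "norm v \<le> B + \<epsilon> / (A + 1)" for u v :: 'e
    proof -
      have "A * norm v \<le> A * (\<epsilon> / (A + 1))"
        using that 2 by (intro mult_left_mono) auto
      also have "\<dots> < \<epsilon>" using 2 \<epsilon> by (simp add: field_simps)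
      finally show ?thesis using 2 by simp
    qed
    then show ?thesis using 2 \<epsilon> by (intro that[of "\<epsilon> / (A + 1)"]) auto
  next
    case 3
    define \<epsilon>' where "\<epsilon>' = \<epsilon> / (2 * A * B)"
    have "\<epsilon>' > 0" using 3 \<epsilon> by (simp add: \<epsilon>'_def)
    then obtain \<delta> where \<delta>: "\<delta> > 0"
      and uc\<delta>: "\<And>a b::'e. norm a \<le> 1 \<Longrightarrow> norm b \<le> 1 \<Longrightarrow> norm (a - b) \<ge> \<epsilon>'
             \<Longrightarrow> norm ((a + b) /\<^sub>R 2) < 1 - \<delta>"
      using uc[unfolded uniformly_convex_def, rule_format, OF \<open>\<epsilon>' > 0\<close>] by meson
    define m where "m = min A B"
    have m: "m > 0" "m \<le> A" "m \<le> B" using 3 by (auto simp: m_def)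
    define \<eta> where "\<eta> = min (2 * m * \<delta>) (\<epsilon> / (2 * A))"
    have \<eta>: "\<eta> > 0" "\<eta> \<le> 2 * m * \<delta>" "\<eta> \<le> \<epsilon> / (2 * A)"
      using m \<delta> \<epsilon> 3 by (auto simp: \<eta>_def)
    show ?thesis
    proof (rule that[OF \<eta>(1)])
      fix u v :: 'e
      assume u: "norm u \<le> A" and v: "norm v \<le> B + \<eta>" and uv: "norm (u + v) \<ge> A + B"
      define a where "a = u /\<^sub>R A"
      define b where "b = v /\<^sub>R (B + \<eta>)"
      have a: "norm a \<le> 1" using u 3 by (simp add: a_def field_simps)
      have b: "norm b \<le> 1" using v 3 \<eta> by (simp add: b_def field_simps)
      have ua: "u = A *\<^sub>R a" using 3 by (simp add: a_def)
      have vb: "v = (B + \<eta>) *\<^sub>R b" using 3 \<eta> by (simp add: b_def)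
      have close: "norm (a - b) < \<epsilon>'"
      proof (rule ccontr)
        assume "\<not> norm (a - b) < \<epsilon>'"
        then have mid: "norm ((a + b) /\<^sub>R 2) < 1 - \<delta>" using uc\<delta> a b by simp
        have "u + v = (2 * m) *\<^sub>R ((a + b) /\<^sub>R 2) + (A - m) *\<^sub>R a + (B + \<eta> - m) *\<^sub>R b"
          by (simp add: ua vb algebra_simps)
        then have "norm (u + v) \<le> norm ((2 * m) *\<^sub>R ((a + b) /\<^sub>R 2)) + norm ((A - m) *\<^sub>R a)
                    + norm ((B + \<eta> - m) *\<^sub>R b)"
          by (simp only:) (intro norm_triangle_le add_right_mono norm_triangle_ineq)
        also have "\<dots> = 2 * m * norm ((a + b) /\<^sub>R 2) + (A - m) * norm a + (B + \<eta> - m) * norm b"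
          using m \<eta> by simp
        also have "\<dots> < 2 * m * (1 - \<delta>) + (A - m) * 1 + (B + \<eta> - m) * 1"
          using m \<eta> a b mid
          by (intro add_less_le_mono mult_left_mono mult_strict_left_mono) auto
        also have "\<dots> \<le> A + B" using \<eta> by (simp add: algebra_simps)
        finally show False using uv by simp
      qed
      have "B *\<^sub>R u - A *\<^sub>R v = (A * B) *\<^sub>R (a - b) - (A * \<eta>) *\<^sub>R b"
        by (simp add: ua vb algebra_simps)
      then have "norm (B *\<^sub>R u - A *\<^sub>R v) \<le> norm ((A * B) *\<^sub>R (a - b)) + norm ((A * \<eta>) *\<^sub>R b)"
        by (metis norm_triangle_ineq4)
      also have "\<dots> = A * B * norm (a - b) + A * \<eta> * norm b"
        using 3 \<eta> by simp
      also have "\<dots> < A * B * \<epsilon>' + A * (\<epsilon> / (2 * A)) * 1"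
        using 3 \<eta> \<epsilon> close b by (intro add_less_le_mono mult_strict_left_mono mult_mono) auto
      also have "\<dots> = \<epsilon>" using 3 by (simp add: \<epsilon>'_def field_simps)
      finally show "norm (B *\<^sub>R u - A *\<^sub>R v) < \<epsilon>" .
    qed
  qed
qed

lemma uniformly_convex_triangle_equality:
  fixes u v :: "'e::real_normed_vector"
  assumes uc: "uniformly_convex TYPE('e)" and uv: "norm (u + v) = norm u + norm v"
  shows "norm v *\<^sub>R u = norm u *\<^sub>R v"
proof (rule ccontr)
  assume "norm v *\<^sub>R u \<noteq> norm u *\<^sub>R v"
  then have "norm (norm v *\<^sub>R u - norm u *\<^sub>R v) > 0" by simp
  then obtain \<eta> where "\<eta> > 0" and
    "\<And>u' v'::'e. norm u' \<le> norm u \<Longrightarrow> norm v' \<le> norm v + \<eta> \<Longrightarrow> norm (u' + v') \<ge> norm u + norm v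
       \<Longrightarrow> norm (norm v *\<^sub>R u' - norm u *\<^sub>R v') < norm (norm v *\<^sub>R u - norm u *\<^sub>R v)"
    using uniformly_convex_near_triangle_equality[OF uc norm_ge_zero norm_ge_zero] by blast
  from this(2)[of u v] this(1) uv show False by simp
qed

section \<open>Length of curves\<close>

lemma sum_le_curve_length:
  fixes t :: "nat \<Rightarrow> real"
  assumes "t ` {0..n} \<subseteq> {a..b}" "mono_on {0..n} t"
  shows "(\<Sum>i=1..n. ennreal (dist (\<gamma> (t (i - 1))) (\<gamma> (t i)))) \<le> curve_length a b \<gamma>"
proof -
  have "(n, t) \<in> {(n::nat, t::nat \<Rightarrow> real). t ` {0..n} \<subseteq> {a..b} \<and> mono_on {0..n} t}"
    using assms by blast
  then show ?thesis
    unfolding curve_length_def by (rule SUP_upper2) simp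
qed

lemma curve_length_le:
  assumes "\<And>(n::nat) t. t ` {0..n} \<subseteq> {a..b} \<Longrightarrow> mono_on {0..n} t
             \<Longrightarrow> (\<Sum>i=1..n. ennreal (dist (\<gamma> (t (i - 1))) (\<gamma> (t i)))) \<le> C"
  shows "curve_length a b \<gamma> \<le> C"
  unfolding curve_length_def by (rule SUP_least) (clarify, rule assms)

text \<open>
  Appending the points \<open>c\<close> and \<open>b\<close> to a partition of \<open>[a, c]\<close> gives a partition of \<open>[a, b]\<close>.
\<close>

lemma curve_length_add_dist_le:
  assumes "a \<le> c" "c \<le> b"
  shows "curve_length a c \<gamma> + ennreal (dist (\<gamma> c) (\<gamma> b)) \<le> curve_length a b \<gamma>"
proof -
  let ?S = "{(n::nat, t::nat \<Rightarrow> real). t ` {0..n} \<subseteq> {a..c} \<and> mono_on {0..n} t}"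
  have ne: "?S \<noteq> {}"
  proof -
    have "(0, \<lambda>_. a) \<in> ?S" using assms by (auto simp: mono_on_def)
    then show ?thesis by blast
  qed
  have bound: "(\<Sum>i=1..n. ennreal (dist (\<gamma> (t (i - 1))) (\<gamma> (t i)))) + ennreal (dist (\<gamma> c) (\<gamma> b))
                \<le> curve_length a b \<gamma>"
    if t: "t ` {0..n} \<subseteq> {a..c}" "mono_on {0..n} t" for n :: nat and t
  proof -
    define t' where "t' = (\<lambda>k. if k \<le> n then t k else if k = Suc n then c else b)"
    have tk: "a \<le> t k" "t k \<le> c" if "k \<le> n" for k
      using t(1) that by (auto simp: image_subset_iff)
    have range: "t' ` {0..Suc (Suc n)} \<subseteq> {a..b}"
      using tk assms by (force simp: t'_def)
    have mono: "mono_on {0..Suc (Suc n)} t'"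
    proof (rule mono_onI)
      fix r s :: nat
      assume "r \<in> {0..Suc (Suc n)}" "s \<in> {0..Suc (Suc n)}" "r \<le> s"
      then show "t' r \<le> t' s"
        using tk[of r] assms mono_onD[OF t(2), of r s] by (auto simp: t'_def)
    qed
    have "(\<Sum>i=1..n. ennreal (dist (\<gamma> (t (i - 1))) (\<gamma> (t i))))
        = (\<Sum>i=1..n. ennreal (dist (\<gamma> (t' (i - 1))) (\<gamma> (t' i))))"
      by (rule sum.cong) (auto simp: t'_def)
    also have "\<dots> + ennreal (dist (\<gamma> c) (\<gamma> b))
        \<le> (\<Sum>i=1..Suc (Suc n). ennreal (dist (\<gamma> (t' (i - 1))) (\<gamma> (t' i))))"
      by (simp add: t'_def add_right_mono)
    also have "\<dots> \<le> curve_length a b \<gamma>"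
      using sum_le_curve_length[OF range mono] .
    finally show ?thesis .
  qed
  have "curve_length a c \<gamma> + ennreal (dist (\<gamma> c) (\<gamma> b))
      = (SUP (n, t) \<in> ?S. (\<Sum>i=1..n. ennreal (dist (\<gamma> (t (i - 1))) (\<gamma> (t i))))
                              + ennreal (dist (\<gamma> c) (\<gamma> b)))"
    unfolding curve_length_def
    by (subst ennreal_SUP_add_left[symmetric, OF ne]) (auto simp: case_prod_unfold)
  also have "\<dots> \<le> curve_length a b \<gamma>"
    by (rule SUP_least) (clarify, rule bound)
  finally show ?thesis .
qed

lemma dist_le_curve_length:
  assumes "a \<le> b"
  shows "ennreal (dist (\<gamma> a) (\<gamma> b)) \<le> curve_length a b \<gamma>"
proof -
  have "ennreal (dist (\<gamma> a) (\<gamma> b)) \<le> curve_length a a \<gamma> + ennreal (dist (\<gamma> a) (\<gamma> b))"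
    by simp
  also have "\<dots> \<le> curve_length a b \<gamma>"
    using assms by (intro curve_length_add_dist_le) auto
  finally show ?thesis .
qed

lemma dist_add_dist_le_curve_length:
  assumes "a \<le> c" "c \<le> b"
  shows "ennreal (dist (\<gamma> a) (\<gamma> c) + dist (\<gamma> c) (\<gamma> b)) \<le> curve_length a b \<gamma>"
proof -
  have "ennreal (dist (\<gamma> a) (\<gamma> c) + dist (\<gamma> c) (\<gamma> b))
      \<le> curve_length a c \<gamma> + ennreal (dist (\<gamma> c) (\<gamma> b))"
    using dist_le_curve_length[OF assms(1), of \<gamma>] by (simp add: add_right_mono ennreal_plus)
  also have "\<dots> \<le> curve_length a b \<gamma>" by (rule curve_length_add_dist_le[OF assms])
  finally show ?thesis .
qed

lemma dist_le_geodesic_dist: "ennreal (dist x y) \<le> geodesic_dist x y"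
  unfolding geodesic_dist_def
  by (rule INF_greatest) (auto simp: curve_from_to_def intro: dist_le_curve_length)

text \<open>For a unit speed geodesic the sums over a partition telescope.\<close>

lemma curve_length_isometric:
  assumes iso: "\<And>s t. s \<in> {0..L} \<Longrightarrow> t \<in> {0..L} \<Longrightarrow> dist (\<sigma> s) (\<sigma> t) = \<bar>s - t\<bar>"
    and s: "s \<in> {0..L}"
  shows "curve_length 0 s \<sigma> = ennreal s"
proof (rule antisym)
  show "curve_length 0 s \<sigma> \<le> ennreal s"
  proof (rule curve_length_le)
    fix n :: nat and t :: "nat \<Rightarrow> real"
    assume t: "t ` {0..n} \<subseteq> {0..s}" "mono_on {0..n} t"
    have tk: "0 \<le> t k" "t k \<le> s" if "k \<le> n" for k
      using t(1) that by (auto simp: image_subset_iff)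
    have "(\<Sum>i=1..n. ennreal (dist (\<sigma> (t (i - 1))) (\<sigma> (t i))))
        = ennreal (\<Sum>i=1..n. dist (\<sigma> (t (i - 1))) (\<sigma> (t i)))"
      by simp
    also have "(\<Sum>i=1..n. dist (\<sigma> (t (i - 1))) (\<sigma> (t i))) = (\<Sum>i=1..n. t i - t (i - 1))"
    proof (rule sum.cong[OF refl])
      fix i assume i: "i \<in> {1..n}"
      have "t (i - 1) \<le> t i" using i by (intro mono_onD[OF t(2)]) auto
      moreover have "t (i - 1) \<in> {0..L}" "t i \<in> {0..L}"
        using i s tk[of i] tk[of "i - 1"] by force+
      ultimately show "dist (\<sigma> (t (i - 1))) (\<sigma> (t i)) = t i - t (i - 1)"
        by (simp add: iso)
    qed
    also have "\<dots> = t n - t 0"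
      by (induction n) auto
    also have "ennreal (t n - t 0) \<le> ennreal s"
      using tk[of 0] tk[of n] by (intro ennreal_leI) auto
    finally show "(\<Sum>i=1..n. ennreal (dist (\<sigma> (t (i - 1))) (\<sigma> (t i)))) \<le> ennreal s" .
  qed
  show "ennreal s \<le> curve_length 0 s \<sigma>"
    using dist_le_curve_length[of 0 s \<sigma>] iso[of 0 s] s by auto
qed

text \<open>
  If the distance of the end points is attained, the triangle inequality leaves no room for an
  initial arc to be longer than the distance of its own end points.
\<close>

lemma shortest_curve_arcs:
  assumes len: "curve_length a b \<gamma> = ennreal (dist (\<gamma> a) (\<gamma> b))" and t: "a \<le> t" "t \<le> b"
  shows "curve_length a t \<gamma> = ennreal (dist (\<gamma> a) (\<gamma> t))"
    and "dist (\<gamma> a) (\<gamma> t) + dist (\<gamma> t) (\<gamma> b) = dist (\<gamma> a) (\<gamma> b)"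
proof -
  have "ennreal (dist (\<gamma> a) (\<gamma> t) + dist (\<gamma> t) (\<gamma> b)) \<le> ennreal (dist (\<gamma> a) (\<gamma> b))"
    using dist_add_dist_le_curve_length[OF t, of \<gamma>] len by simp
  then show eq: "dist (\<gamma> a) (\<gamma> t) + dist (\<gamma> t) (\<gamma> b) = dist (\<gamma> a) (\<gamma> b)"
    using dist_triangle[of "\<gamma> a" "\<gamma> b" "\<gamma> t"] by (simp add: ennreal_le_iff del: ennreal_plus)
  have "curve_length a t \<gamma> + ennreal (dist (\<gamma> t) (\<gamma> b))
      \<le> ennreal (dist (\<gamma> a) (\<gamma> t)) + ennreal (dist (\<gamma> t) (\<gamma> b))"
    using curve_length_add_dist_le[OF t, of \<gamma>] len eq by (simp flip: ennreal_plus)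
  then have "curve_length a t \<gamma> \<le> ennreal (dist (\<gamma> a) (\<gamma> t))"
    by (simp add: ennreal_add_left_cancel_le add.commute)
  with dist_le_curve_length[OF t(1), of \<gamma>]
  show "curve_length a t \<gamma> = ennreal (dist (\<gamma> a) (\<gamma> t))" by simp
qed

text \<open>
  The intermediate value theorem, applied to the distance from \<open>x\<close> along a nearly shortest curve.
\<close>

lemma nearly_between_point:
  assumes geo: "geodesic_dist x y < ennreal C" and A: "0 \<le> A" "A \<le> dist x y"
  obtains z where "dist x z = A" "dist x z + dist z y \<le> C"
proof -
  obtain a b \<gamma> where c: "curve_from_to a b \<gamma> x y" and len: "curve_length a b \<gamma> < ennreal C"
    using geo unfolding geodesic_dist_def INF_less_iff by auto
  have ab: "a \<le> b" "continuous_on {a..b} \<gamma>" "\<gamma> a = x" "\<gamma> b = y"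
    using c by (auto simp: curve_from_to_def)
  have "\<exists>t. a \<le> t \<and> t \<le> b \<and> dist x (\<gamma> t) = A"
    using ab A by (intro IVT') (auto intro!: continuous_intros)
  then obtain t where t: "a \<le> t" "t \<le> b" "dist x (\<gamma> t) = A" by blast
  have "ennreal (dist x (\<gamma> t) + dist (\<gamma> t) y) < ennreal C"
    using dist_add_dist_le_curve_length[OF t(1,2), of \<gamma>] len ab by simp
  then have "dist x (\<gamma> t) + dist (\<gamma> t) y \<le> C"
    by (simp add: ennreal_less_iff del: ennreal_plus)
  with t(3) show ?thesis by (rule that)
qed

section \<open>Isometric immersions into a uniformly convex space\<close>

lemma closed_range_isometry:
  fixes i :: "'m::complete_space \<Rightarrow> 'e::metric_space"
  assumes iso: "\<And>x y. dist (i x) (i y) = dist x y"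
  shows "closed (range i)"
  unfolding closed_sequential_limits
proof (intro allI impI)
  fix f l assume "(\<forall>n. f n \<in> range i) \<and> f \<longlonglongrightarrow> l"
  then have fr: "\<forall>n. \<exists>z. f n = i z" and fl: "f \<longlonglongrightarrow> l" by auto
  from fr obtain z where f: "\<And>n. f n = i (z n)" by metis
  have "Cauchy z"
    using LIMSEQ_imp_Cauchy[OF fl] by (simp add: Cauchy_def f iso)
  then obtain z0 where "z \<longlonglongrightarrow> z0"
    using Cauchy_convergent convergent_def by blast
  then have "f \<longlonglongrightarrow> i z0"
    by (simp add: tendsto_dist_iff[of _ "i z0"] tendsto_dist_iff[of z] f iso)
  with fl have "l = i z0" by (rule LIMSEQ_unique)
  then show "l \<in> range i" by simp
qed

lemma closed_segment_subset_range:
  fixes i :: "'m::complete_space \<Rightarrow> 'e::real_normed_vector"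
  assumes uc: "uniformly_convex TYPE('e)"
    and iso: "\<And>x y. norm (i x - i y) = dist x y"
    and geo: "ennreal (dist x y) = geodesic_dist x y"
  shows "closed_segment (i x) (i y) \<subseteq> range i"
proof (cases "x = y")
  case True
  then show ?thesis by simp
next
  case False
  define D where "D = dist x y"
  have D: "D > 0" using False by (simp add: D_def)
  have "closed (range i)" using iso by (intro closed_range_isometry) (simp add: dist_norm)
  moreover have "w \<in> closure (range i)" if "w \<in> closed_segment (i x) (i y)" for w
  proof -
    from that obtain s where s: "0 \<le> s" "s \<le> 1" and w: "w = (1 - s) *\<^sub>R i x + s *\<^sub>R i y"
      by (auto simp: in_segment)
    define A where "A = s * D"
    define B where "B = (1 - s) * D"
    have AB: "A \<ge> 0" "B \<ge> 0" "A + B = D" "A \<le> D"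
      using s D by (auto simp: A_def B_def algebra_simps mult_left_le_one_le)
    show ?thesis
      unfolding closure_approachable
    proof (intro allI impI)
      fix \<epsilon> :: real assume \<epsilon>: "\<epsilon> > 0"
      then have "D * \<epsilon> > 0" using D by simp
      from uniformly_convex_near_triangle_equality[OF uc AB(1,2) this]
      obtain \<eta> where \<eta>: "\<eta> > 0" and near:
        "\<And>u v::'e. norm u \<le> A \<Longrightarrow> norm v \<le> B + \<eta> \<Longrightarrow> norm (u + v) \<ge> A + B
           \<Longrightarrow> norm (B *\<^sub>R u - A *\<^sub>R v) < D * \<epsilon>" by blast
      have "geodesic_dist x y < ennreal (D + \<eta>)"
        unfolding geo[symmetric] using D \<eta> by (intro ennreal_lessI) (auto simp: D_def add_nonneg_pos)
      then obtain z where z: "dist x z = A" "dist x z + dist z y \<le> D + \<eta>"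
        using AB by (elim nearly_between_point) (auto simp: D_def)
      have "norm (B *\<^sub>R (i z - i x) - A *\<^sub>R (i y - i z)) < D * \<epsilon>"
        using z AB by (intro near) (auto simp: iso dist_commute D_def)
      also have "B *\<^sub>R (i z - i x) - A *\<^sub>R (i y - i z) = D *\<^sub>R (i z - w)"
        by (simp add: A_def B_def w algebra_simps)
      finally have "dist (i z) w < \<epsilon>" using D by (simp add: dist_norm)
      then show "\<exists>v\<in>range i. dist v w < \<epsilon>" by blast
    qed
  qed
  ultimately show ?thesis by (auto simp: closure_closed)
qed

text \<open>
  The pullback of the segment, run through with unit speed.  For \<open>x = y\<close> the interval \<open>{0..dist x y}\<close>
  is a point and the quotient \<open>s / dist x y\<close> is \<open>0\<close>, so the formula remains correct.
\<close>

lemma unit_speed_segment: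
  fixes i :: "'m::metric_space \<Rightarrow> 'e::real_normed_vector"
  assumes iso: "\<And>x y. norm (i x - i y) = dist x y"
    and seg: "closed_segment (i x) (i y) \<subseteq> range i"
  obtains \<sigma> where
    "\<And>s. s \<in> {0..dist x y} \<Longrightarrow> i (\<sigma> s) = i x + (s / dist x y) *\<^sub>R (i y - i x)"
    "\<And>s t. s \<in> {0..dist x y} \<Longrightarrow> t \<in> {0..dist x y} \<Longrightarrow> dist (\<sigma> s) (\<sigma> t) = \<bar>s - t\<bar>"
proof -
  have "\<exists>z. i z = i x + (s / dist x y) *\<^sub>R (i y - i x)" if s: "s \<in> {0..dist x y}" for s
  proof -
    have "i x + (s / dist x y) *\<^sub>R (i y - i x)
        = (1 - s / dist x y) *\<^sub>R i x + (s / dist x y) *\<^sub>R i y"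
      by (simp add: algebra_simps)
    moreover have "0 \<le> s / dist x y" "s / dist x y \<le> 1"
      using s by (auto simp: divide_le_eq_1)
    ultimately have "i x + (s / dist x y) *\<^sub>R (i y - i x) \<in> closed_segment (i x) (i y)"
      by (auto simp: in_segment)
    with seg show ?thesis by (metis imageE subsetD)
  qed
  then obtain \<sigma> where \<sigma>: "\<And>s. s \<in> {0..dist x y} \<Longrightarrow> i (\<sigma> s) = i x + (s / dist x y) *\<^sub>R (i y - i x)"
    by metis
  have "dist (\<sigma> s) (\<sigma> t) = \<bar>s - t\<bar>" if st: "s \<in> {0..dist x y}" "t \<in> {0..dist x y}" for s t
  proof (cases "x = y")
    case True
    then show ?thesis using st by simp
  next
    case False
    have "i (\<sigma> s) - i (\<sigma> t) = ((s - t) / dist x y) *\<^sub>R (i y - i x)"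
      using st by (simp add: \<sigma> algebra_simps diff_divide_distrib)
    then have "dist (\<sigma> s) (\<sigma> t) = \<bar>(s - t) / dist x y\<bar> * dist x y"
      by (simp flip: iso add: norm_minus_commute)
    also have "\<dots> = \<bar>s - t\<bar>" using False by simp
    finally show ?thesis .
  qed
  with \<sigma> show ?thesis by (rule that)
qed

text \<open>
  Metric betweenness pins a point down: by the exact case of rigidity its image is the point of the
  segment at the same distance from \<open>i x\<close>.
\<close>

lemma between_point_unique:
  fixes i :: "'m::metric_space \<Rightarrow> 'e::real_normed_vector"
  assumes uc: "uniformly_convex TYPE('e)"
    and iso: "\<And>x y. norm (i x - i y) = dist x y"
    and btw: "dist x z + dist z y = dist x y"
  shows "i z = i x + (dist x z / dist x y) *\<^sub>R (i y - i x)"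
proof (cases "x = y")
  case True
  then have "dist x z = 0" using btw by (simp add: dist_commute)
  then show ?thesis by simp
next
  case False
  have "dist z y *\<^sub>R (i z - i x) = dist x z *\<^sub>R (i y - i z)"
    using uniformly_convex_triangle_equality[OF uc, of "i z - i x" "i y - i z"] btw
    by (simp add: iso dist_commute)
  then have "dist x y *\<^sub>R (i z - i x) = dist x z *\<^sub>R (i y - i x)"
    by (simp add: btw[symmetric] algebra_simps)
  then have "(1 / dist x y) *\<^sub>R dist x y *\<^sub>R (i z - i x)
      = (1 / dist x y) *\<^sub>R dist x z *\<^sub>R (i y - i x)"
    by simp
  then have "i z - i x = (dist x z / dist x y) *\<^sub>R (i y - i x)"
    using False by simp
  then show ?thesis by (simp add: algebra_simps)
qed

text \<open>
  One \<open>\<sigma>\<close> serves all minimal geodesics from \<open>x\<close> to \<open>y\<close>, since it is described by the segment alone: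
  a point \<open>\<gamma> t\<close> lies metrically between \<open>x\<close> and \<open>y\<close>, so it is determined by its distance
  to \<open>x\<close>, and that distance is the arc length of \<open>\<gamma>\<close> up to \<open>t\<close>.
\<close>

lemma minimal_geodesic_arclength:
  fixes i :: "'m::metric_space \<Rightarrow> 'e::real_normed_vector"
  assumes uc: "uniformly_convex TYPE('e)"
    and iso: "\<And>x y. norm (i x - i y) = dist x y"
    and geo: "ennreal (dist x y) = geodesic_dist x y"
    and \<sigma>: "\<And>s. s \<in> {0..dist x y} \<Longrightarrow> i (\<sigma> s) = i x + (s / dist x y) *\<^sub>R (i y - i x)"
    and \<sigma>_iso: "\<And>s t. s \<in> {0..dist x y} \<Longrightarrow> t \<in> {0..dist x y} \<Longrightarrow> dist (\<sigma> s) (\<sigma> t) = \<bar>s - t\<bar>"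
    and \<gamma>: "minimal_geodesic a b \<gamma> x y"
  shows "arclength_parametrization a b \<gamma> \<sigma>"
proof -
  have ends: "\<gamma> a = x" "\<gamma> b = y"
    using \<gamma> by (auto simp: minimal_geodesic_def curve_from_to_def)
  have len: "curve_length a b \<gamma> = ennreal (dist x y)"
    using \<gamma> geo by (simp add: minimal_geodesic_def)
  have "continuous_on {0..dist x y} \<sigma>"
    unfolding continuous_on_iff using \<sigma>_iso by (metis dist_real_def)
  moreover have "curve_length 0 s \<sigma> = ennreal s" if "s \<in> {0..dist x y}" for s
    using curve_length_isometric[of "dist x y" \<sigma> s] \<sigma>_iso that by blast
  moreover have "\<gamma> t = \<sigma> (enn2real (curve_length a t \<gamma>))" if t: "t \<in> {a..b}" for t
  proof -
    have len_t: "curve_length a t \<gamma> = ennreal (dist x (\<gamma> t))"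
      and btw: "dist x (\<gamma> t) + dist (\<gamma> t) y = dist x y"
      using shortest_curve_arcs[of a b \<gamma> t] len ends t by auto
    have "dist x (\<gamma> t) \<in> {0..dist x y}"
      using btw zero_le_dist[of x "\<gamma> t"] zero_le_dist[of "\<gamma> t" y]
      unfolding atLeastAtMost_iff by linarith
    then have "i (\<gamma> t) = i (\<sigma> (dist x (\<gamma> t)))"
      using between_point_unique[OF uc iso btw] \<sigma> by simp
    then have "\<gamma> t = \<sigma> (dist x (\<gamma> t))"
      using iso[of "\<gamma> t" "\<sigma> (dist x (\<gamma> t))"] by simp
    then show ?thesis by (simp add: len_t)
  qed
  ultimately show ?thesis by (simp add: arclength_parametrization_def len)
qed

theorem theorem2p11:
  fixes i :: "'m::complete_space \<Rightarrow> 'e::banach"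
  assumes "uniformly_convex TYPE('e)"
    and "\<And>x y. norm (i x - i y) = dist x y"
  shows "(\<forall>x y. ennreal (dist x y) = geodesic_dist x y \<longrightarrow>
            closed_segment (i x) (i y) \<subseteq> range i) \<and>
         (path_metric TYPE('m) \<longrightarrow>
            convex (range i) \<and>
            (\<forall>x y::'m.
               (\<exists>a b \<gamma>. minimal_geodesic a b \<gamma> x y) \<and>
               (\<forall>a b \<gamma> a' b' \<gamma>'.
                  minimal_geodesic a b \<gamma> x y \<and> minimal_geodesic a' b' \<gamma>' x y \<longrightarrow>
                  (\<exists>\<sigma>. arclength_parametrization a b \<gamma> \<sigma> \<and>
                       arclength_parametrization a' b' \<gamma>' \<sigma>))))"
proof (rule conjI)
  note uc = assms(1) and iso = assms(2)
  show seg: "\<forall>x y. ennreal (dist x y) = geodesic_dist x y \<longrightarrow>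
               closed_segment (i x) (i y) \<subseteq> range i"
    using closed_segment_subset_range[OF uc iso] by blast
  show "path_metric TYPE('m) \<longrightarrow>
            convex (range i) \<and>
            (\<forall>x y::'m.
               (\<exists>a b \<gamma>. minimal_geodesic a b \<gamma> x y) \<and>
               (\<forall>a b \<gamma> a' b' \<gamma>'.
                  minimal_geodesic a b \<gamma> x y \<and> minimal_geodesic a' b' \<gamma>' x y \<longrightarrow>
                  (\<exists>\<sigma>. arclength_parametrization a b \<gamma> \<sigma> \<and>
                       arclength_parametrization a' b' \<gamma>' \<sigma>)))"
  proof (rule impI, rule conjI)
    assume "path_metric TYPE('m)"
    then have geo: "ennreal (dist x y) = geodesic_dist x y" for x y :: 'm
      by (simp add: path_metric_def)
    show "convex (range i)"
      using seg geo by (auto simp: convex_contains_segment)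
    show "\<forall>x y::'m.
               (\<exists>a b \<gamma>. minimal_geodesic a b \<gamma> x y) \<and>
               (\<forall>a b \<gamma> a' b' \<gamma>'.
                  minimal_geodesic a b \<gamma> x y \<and> minimal_geodesic a' b' \<gamma>' x y \<longrightarrow>
                  (\<exists>\<sigma>. arclength_parametrization a b \<gamma> \<sigma> \<and>
                       arclength_parametrization a' b' \<gamma>' \<sigma>))"
    proof (intro allI, rule conjI)
      fix x y :: 'm
      have "closed_segment (i x) (i y) \<subseteq> range i" using seg geo by blast
      then obtain \<sigma> where
        \<sigma>: "\<And>s. s \<in> {0..dist x y} \<Longrightarrow> i (\<sigma> s) = i x + (s / dist x y) *\<^sub>R (i y - i x)" and
        \<sigma>_iso: "\<And>s t. s \<in> {0..dist x y} \<Longrightarrow> t \<in> {0..dist x y} \<Longrightarrow> dist (\<sigma> s) (\<sigma> t) = \<bar>s - t\<bar>"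
        using unit_speed_segment[of i x y] iso by blast
      have "i (\<sigma> 0) = i x" "i (\<sigma> (dist x y)) = i y"
        using \<sigma>[of 0] \<sigma>[of "dist x y"] by (cases "x = y"; simp)+
      then have "\<sigma> 0 = x" "\<sigma> (dist x y) = y"
        using iso[of "\<sigma> 0" x] iso[of "\<sigma> (dist x y)" y] by auto
      moreover have "continuous_on {0..dist x y} \<sigma>"
        unfolding continuous_on_iff using \<sigma>_iso by (metis dist_real_def)
      moreover have "curve_length 0 (dist x y) \<sigma> = ennreal (dist x y)"
        using curve_length_isometric[of "dist x y" \<sigma> "dist x y"] \<sigma>_iso by auto
      ultimately have "minimal_geodesic 0 (dist x y) \<sigma> x y"
        using geo by (simp add: minimal_geodesic_def curve_from_to_def)
      then show "\<exists>a b \<gamma>. minimal_geodesic a b \<gamma> x y" by blast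
      show "\<forall>a b \<gamma> a' b' \<gamma>'.
                  minimal_geodesic a b \<gamma> x y \<and> minimal_geodesic a' b' \<gamma>' x y \<longrightarrow>
                  (\<exists>\<sigma>. arclength_parametrization a b \<gamma> \<sigma> \<and>
                       arclength_parametrization a' b' \<gamma>' \<sigma>)"
        using minimal_geodesic_arclength[OF uc iso geo \<sigma> \<sigma>_iso] by blast
    qed
  qed
qed

end
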